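(* Let $(x^{\star},y^{\star})\in\mathrm{dom}(Q)$ and suppose that $g^*$ is continuous on $\mathrm{dom}(g^* )$. Then $x^{\star}$ is a critical point of $F$ with $F(x^{\star})y^{\star}\in F(x^{\star})\,\partial g(x^{\star})$ if and only if $(x^{\star},y^{\star})$ is a stationary point of $Q$, i.e. $0\in\widehat{\partial}Q(x^{\star},y^{\star})$.
   Context: Setting. $f,g,h:\mathbb{R}^n\to(-\infty,+\infty]$ are proper lower semicontinuous functions, $\Omega:=\{x\in\mathbb{R}^n: g(x)\neq 0\}$ is nonempty, and $f$ is block-separable: $f(x)=\sum_{i=1}^N f_i(x_i)$, where the subvectors $x_i\in\mathbb{R}^{n_i}$ form a partition of the components of $x$ and each $f_i:\mathbb{R}^{n_i}\to(-\infty,+\infty]$ is proper lower semicontinuous. Standing assumptions: (a) $f$ is continuous on $\mathrm{dom}(f)$ and each $f_i$ is bounded below; (b) $h$ is locally Lipschitz differentiable on $\Omega$, i.e. every $x\in\Omega$ has a neighborhood $\mathcal{B}(x)$ and a constant $L_x$ with $\|\nabla h(u)-\nabla h(v)\|_2\le L_x\|u-v\|_2$ for all $u,v\in\mathcal{B}(x)\cap\Omega$; (c) $g$ is convex, real-valued and nonnegative on $\mathbb{R}^n$; (d) $f+h\ge 0$ on $\mathrm{dom}(f)$. Notation. $\mathrm{dom}(\varphi)=\{x:\varphi(x)<+\infty\}$; $g^*(y)=\sup_x\{\langle x,y\rangle-g(x)\}$; $\zeta(x):=f(x)+h(x)$; $\eta(x,y):=\langle x,y\rangle-g^*(y)$.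 $F(x)=\zeta(x)/g(x)$ if $x\in\Omega\cap\mathrm{dom}(f)$ and $F(x)=+\infty$ otherwise. $Q(x,y)=\zeta(x)/\eta(x,y)$ if $(x,y)\in\mathrm{dom}(f)\times\mathrm{dom}(g^* )$ and $\eta(x,y)>0$, and $Q(x,y)=+\infty$ otherwise. For a scalar $a$ and a set $S$, $aS=\{as:s\in S\}$. The Fréchet subdifferential of a proper function $\varphi$ at $x\in\mathrm{dom}(\varphi)$ is $\widehat{\partial}\varphi(x)=\{y:\liminf_{z\to x,z\ne x}\frac{\varphi(z)-\varphi(x)-\langle y,z-x\rangle}{\|z-x\|_2}\ge 0\}$; $\partial g$ is the convex subdifferential. A point $x^{\star}\in\mathrm{dom}(F)$ is a critical point of $F$ if $0\in\widehat{\partial}f(x^{\star})+\nabla h(x^{\star})-F(x^{\star})\,\partial g(x^{\star})$.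
   Formalization: The critical-point side also requires F(x* )y* to lie in the Fréchet subdifferential of f at x* plus ∇h(x* ), i.e. y* itself realises criticality; without this the claim fails, e.g. f=0, h=1, g=max(x,1), x*=y*=1. *)

theory Defs
  imports "HOL-Analysis.Analysis" "HOL-Library.Disjoint_Sets" "HOL-Library.Set_Algebras"
begin

definition edom :: "('a \<Rightarrow> ereal) \<Rightarrow> 'a set" where
  "edom \<phi> = {x. \<phi> x < \<infinity>}"

definition proper :: "('a \<Rightarrow> ereal) \<Rightarrow> bool" where
  "proper \<phi> \<longleftrightarrow> (\<forall>x. \<phi> x \<noteq> -\<infinity>) \<and> edom \<phi> \<noteq> {}"

definition lsc :: "('a::topological_space \<Rightarrow> ereal) \<Rightarrow> bool" where
  "lsc \<phi> \<longleftrightarrow> (\<forall>x. \<phi> x \<le> Liminf (at x) \<phi>)"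

definition bounded_from_below :: "('a \<Rightarrow> ereal) \<Rightarrow> bool" where
  "bounded_from_below \<phi> \<longleftrightarrow> (\<exists>c::real. \<forall>x. ereal c \<le> \<phi> x)"

text \<open>
  A block of coordinates is a subset \<open>B\<close> of the index type, and \<open>block B x\<close> represents the
  subvector of \<open>x\<close> with coordinates in \<open>B\<close>, the space of dimension \<open>card B\<close> being identified
  with the coordinate subspace of the vectors that vanish outside \<open>B\<close>.  A function \<open>u\<close> on that
  space is proper, lower semicontinuous or bounded below iff \<open>\<lambda>x. u (block B x)\<close> is.
\<close>

definition block :: "'n set \<Rightarrow> real ^ 'n \<Rightarrow> real ^ 'n" where
  "block B x = (\<chi> j. if j \<in> B then x $ j else 0)"

text \<open>
  At a point \<open>x\<close> outside the domain the Frechet subdifferential is empty by convention.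
\<close>

definition frechet_subdiff :: "('a::real_inner \<Rightarrow> ereal) \<Rightarrow> 'a \<Rightarrow> 'a set" where
  "frechet_subdiff \<phi> x =
     {y. x \<in> edom \<phi> \<and>
         0 \<le> Liminf (at x) (\<lambda>z. (\<phi> z - \<phi> x - ereal (y \<bullet> (z - x))) / ereal (norm (z - x)))}"

definition convex_subdiff :: "('a::real_inner \<Rightarrow> real) \<Rightarrow> 'a \<Rightarrow> 'a set" where
  "convex_subdiff g x = {v. \<forall>z. g z \<ge> g x + v \<bullet> (z - x)}"

definition conjugate :: "('a::real_inner \<Rightarrow> real) \<Rightarrow> 'a \<Rightarrow> ereal" where
  "conjugate g y = (SUP x. ereal (x \<bullet> y - g x))"

text \<open>
  The gradient is taken of the real part of an extended-real-valued function; this is the usual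
  gradient at points around which the function is finite.  Finiteness on the open set \<open>S\<close> is
  therefore part of the next definition.
\<close>

definition gradient :: "('a::real_inner \<Rightarrow> ereal) \<Rightarrow> 'a \<Rightarrow> 'a" where
  "gradient h x = (THE D. GDERIV (\<lambda>u. real_of_ereal (h u)) x :> D)"

definition locally_lipschitz_differentiable_on ::
    "('a::real_inner \<Rightarrow> ereal) \<Rightarrow> 'a set \<Rightarrow> bool" where
  "locally_lipschitz_differentiable_on h S \<longleftrightarrow>
     (\<forall>x\<in>S. \<bar>h x\<bar> \<noteq> \<infinity> \<and> (\<lambda>u. real_of_ereal (h u)) differentiable (at x)) \<and>
     (\<forall>x\<in>S. \<exists>B L. open B \<and> x \<in> B \<and> L-lipschitz_on (B \<inter> S) (gradient h))"

definition Omega :: "('a \<Rightarrow> real) \<Rightarrow> 'a set" where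
  "Omega g = {x. g x \<noteq> 0}"

definition zeta :: "('a \<Rightarrow> ereal) \<Rightarrow> ('a \<Rightarrow> ereal) \<Rightarrow> 'a \<Rightarrow> ereal" where
  "zeta f h x = f x + h x"

definition eta :: "('a::real_inner \<Rightarrow> real) \<Rightarrow> 'a \<Rightarrow> 'a \<Rightarrow> ereal" where
  "eta g x y = ereal (x \<bullet> y) - conjugate g y"

definition F_fun :: "('a \<Rightarrow> ereal) \<Rightarrow> ('a \<Rightarrow> real) \<Rightarrow> ('a \<Rightarrow> ereal) \<Rightarrow> 'a \<Rightarrow> ereal" where
  "F_fun f g h x =
     (if x \<in> Omega g \<inter> edom f then zeta f h x / ereal (g x) else \<infinity>)"

definition Q_fun ::
    "('a::real_inner \<Rightarrow> ereal) \<Rightarrow> ('a \<Rightarrow> real) \<Rightarrow> ('a \<Rightarrow> ereal) \<Rightarrow> 'a \<times> 'a \<Rightarrow> ereal" where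
  "Q_fun f g h = (\<lambda>(x, y).
     if (x, y) \<in> edom f \<times> edom (conjugate g) \<and> eta g x y > 0
     then zeta f h x / eta g x y else \<infinity>)"

definition scaled_set :: "real \<Rightarrow> 'a::real_vector set \<Rightarrow> 'a set" where
  "scaled_set a S = {a *\<^sub>R s | s. s \<in> S}"

text \<open>
  The Minkowski difference is written out as a comprehension, since \<open>A - B\<close> on sets is the set
  difference.

  The condition only asks for some subgradient of \<open>g\<close>.  That \<open>x\<close> is critical with a
  prescribed \<open>F x *\<^sub>R y\<close> in the scaled subdifferential means that this element is
  the one for which the inclusion holds, i.e. that it also lies in
  \<open>gradient h x +o frechet_subdiff f x\<close>; if \<open>g\<close> is not differentiable at \<open>x\<close>, this is more than
  the two separate conditions.
\<close>

definition critical_point ::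
    "('a::real_inner \<Rightarrow> ereal) \<Rightarrow> ('a \<Rightarrow> real) \<Rightarrow> ('a \<Rightarrow> ereal) \<Rightarrow> 'a \<Rightarrow> bool" where
  "critical_point f g h x \<longleftrightarrow>
     x \<in> edom (F_fun f g h) \<and>
     0 \<in> {u + gradient h x - w | u w.
           u \<in> frechet_subdiff f x \<and>
           w \<in> scaled_set (real_of_ereal (F_fun f g h x)) (convex_subdiff g x)}"

end

theory Submission
  imports Defs
begin

text \<open>
  Write \<open>a = zeta(x*)\<close>, \<open>e = eta(x*, y*)\<close> and \<open>G = g(x*)\<close>, so that \<open>0 < e \<le> G\<close>.  If \<open>a = 0\<close>,
  then \<open>(x*, y*)\<close> minimizes \<open>Q\<close> and \<open>x*\<close> minimizes \<open>zeta\<close>, and both sides hold.  Let \<open>a > 0\<close>.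
  Since \<open>eta(x*, -)\<close> is concave, stationarity of \<open>Q\<close> in \<open>y\<close> forces \<open>e = G\<close>, i.e. \<open>y*\<close> is a
  subgradient of \<open>g\<close> at \<open>x*\<close>; stationarity in \<open>x\<close> says that \<open>(a/G) y*\<close> is a Frechet subgradient
  of \<open>zeta\<close>, because \<open>eta(-, y*)\<close> is affine.  Conversely,
  \<open>eta(x, y) \<le> G + \<langle>x - x*, y\<rangle>\<close> gives
  \<open>zeta(x) - (a/G) eta(x, y) \<ge> -o(\<parallel>(x, y) - (x*, y*)\<parallel>)\<close>.  Dividing by \<open>eta(x, y)\<close> is harmless
  where \<open>eta(x, y) \<ge> G/2\<close>, and where \<open>eta(x, y) < G/2\<close> the quotient exceeds \<open>a/G\<close> anyway,
  since \<open>liminf zeta(x) \<ge> a\<close> as \<open>x\<close> tends to \<open>x*\<close>.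
\<close>

section \<open>Frechet subgradients of extended-real-valued functions\<close>

text \<open>Multiplying by \<open>norm (z - x)\<close> removes the quotient from the lower limit.
  The resulting local minorant makes sense for infinite \<open>\<phi> z\<close> as well, and this is
  the form in which all later estimates are made.\<close>

lemma frechet_subdiff_iff:
  fixes \<phi> :: "'a::real_inner \<Rightarrow> ereal"
  assumes "\<phi> x = ereal r"
  shows "v \<in> frechet_subdiff \<phi> x \<longleftrightarrow>
    (\<forall>\<epsilon>>0. \<forall>\<^sub>F z in nhds x. ereal (r + v \<bullet> (z - x) - \<epsilon> * norm (z - x)) \<le> \<phi> z)"
proof -
  have lt: "ereal c < (\<phi> z - \<phi> x - ereal (v \<bullet> (z - x))) / ereal (norm (z - x)) \<longleftrightarrow>
      ereal (r + v \<bullet> (z - x) + c * norm (z - x)) < \<phi> z" if "z \<noteq> x" for z c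
  proof -
    have "0 < norm (z - x)" using that by simp
    then show ?thesis
      using assms by (cases "\<phi> z") (auto simp: pos_less_divide_eq)
  qed
  have "v \<in> frechet_subdiff \<phi> x \<longleftrightarrow>
      (\<forall>y<0. \<forall>\<^sub>F z in at x. y < (\<phi> z - \<phi> x - ereal (v \<bullet> (z - x))) / ereal (norm (z - x)))"
    using assms by (simp add: frechet_subdiff_def edom_def le_Liminf_iff)
  also have "\<dots> \<longleftrightarrow> (\<forall>\<epsilon>>0. \<forall>\<^sub>F z in at x.
      ereal (- \<epsilon>) < (\<phi> z - \<phi> x - ereal (v \<bullet> (z - x))) / ereal (norm (z - x)))"
    (is "(\<forall>y<0. ?E y) \<longleftrightarrow> (\<forall>\<epsilon>>0. ?E (ereal (- \<epsilon>)))")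
  proof (intro iffI allI impI)
    fix y :: ereal assume *: "\<forall>\<epsilon>>0. ?E (ereal (- \<epsilon>))" and y: "y < 0"
    \<comment> \<open>The bound \<open>y\<close> may be \<open>-\<infinity>\<close>, so a real
      number between \<open>y\<close> and 0 takes its place.\<close>
    obtain c where "y < ereal c" "ereal c < 0"
      using ereal_dense2[OF y] by auto
    with *[rule_format, of "- c"] have "?E (ereal c)" by simp
    then show "?E y"
      by (rule eventually_mono) (rule less_trans[OF \<open>y < ereal c\<close>])
  qed auto
  also have "\<dots> \<longleftrightarrow> (\<forall>\<epsilon>>0. \<forall>\<^sub>F z in at x. ereal (r + v \<bullet> (z - x) - \<epsilon> * norm (z - x)) < \<phi> z)"
  proof -
    have "(\<forall>\<^sub>F z in at x.
        ereal (- \<epsilon>) < (\<phi> z - \<phi> x - ereal (v \<bullet> (z - x))) / ereal (norm (z - x))) \<longleftrightarrow>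
      (\<forall>\<^sub>F z in at x. ereal (r + v \<bullet> (z - x) - \<epsilon> * norm (z - x)) < \<phi> z)" for \<epsilon>
      by (rule eventually_cong[OF eventually_neq_at_within[of x x UNIV]])
        (use lt[of _ "- \<epsilon>"] in simp)
    then show ?thesis by simp
  qed
  also have "\<dots> \<longleftrightarrow>
      (\<forall>\<epsilon>>0. \<forall>\<^sub>F z in at x. ereal (r + v \<bullet> (z - x) - \<epsilon> * norm (z - x)) \<le> \<phi> z)"
  proof (intro iffI allI impI)
    fix \<epsilon> :: real
    assume "\<forall>\<epsilon>>0. \<forall>\<^sub>F z in at x. ereal (r + v \<bullet> (z - x) - \<epsilon> * norm (z - x)) \<le> \<phi> z" "\<epsilon> > 0"
    \<comment> \<open>Halving \<epsilon> recovers strictness, since \<open>norm (z - x)\<close> is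
      positive off \<open>x\<close>.\<close>
    then have "\<forall>\<^sub>F z in at x. ereal (r + v \<bullet> (z - x) - \<epsilon> / 2 * norm (z - x)) \<le> \<phi> z"
      by (meson half_gt_zero)
    with eventually_neq_at_within[of x x UNIV]
    show "\<forall>\<^sub>F z in at x. ereal (r + v \<bullet> (z - x) - \<epsilon> * norm (z - x)) < \<phi> z"
    proof eventually_elim
      case (elim z)
      have "r + v \<bullet> (z - x) - \<epsilon> * norm (z - x) < r + v \<bullet> (z - x) - \<epsilon> / 2 * norm (z - x)"
        using elim(1) \<open>\<epsilon> > 0\<close> by (simp add: field_simps)
      with elim(2) show ?case by (meson less_ereal.simps(1) less_le_trans)
    qed
  qed (auto elim!: eventually_mono)
  \<comment> \<open>At \<open>z = x\<close> both sides equal \<open>r\<close>, so the non-strict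
    inequality extends to the full neighbourhood.\<close>
  also have "\<dots> \<longleftrightarrow>
      (\<forall>\<epsilon>>0. \<forall>\<^sub>F z in nhds x. ereal (r + v \<bullet> (z - x) - \<epsilon> * norm (z - x)) \<le> \<phi> z)"
    using assms by (simp add: eventually_nhds_conv_at)
  finally show ?thesis .
qed

lemma zero_in_frechet_subdiff_if_minimum:
  fixes \<phi> :: "'a::real_inner \<Rightarrow> ereal"
  assumes "\<phi> x = ereal r" "\<And>z. ereal r \<le> \<phi> z"
  shows "0 \<in> frechet_subdiff \<phi> x"
  unfolding frechet_subdiff_iff[of \<phi>, OF assms(1)]
proof (intro allI impI, rule always_eventually, rule allI)
  fix \<epsilon> :: real and z assume "\<epsilon> > 0"
  then have "ereal (r + 0 \<bullet> (z - x) - \<epsilon> * norm (z - x)) \<le> ereal r" by simp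
  then show "ereal (r + 0 \<bullet> (z - x) - \<epsilon> * norm (z - x)) \<le> \<phi> z"
    using assms(2) by (rule order_trans)
qed

text \<open>The derivative \<open>d\<close> is represented by the vector \<open>adjoint d 1\<close>,
  and uniqueness of derivatives makes the description in \<open>gradient\<close> well
  defined.\<close>

lemma GDERIV_gradient:
  fixes h :: "'a::euclidean_space \<Rightarrow> ereal"
  assumes "(\<lambda>u. real_of_ereal (h u)) differentiable (at x)"
  shows "GDERIV (\<lambda>u. real_of_ereal (h u)) x :> gradient h x"
proof -
  obtain d where d: "((\<lambda>u. real_of_ereal (h u)) has_derivative d) (at x)"
    using assms by (auto simp: differentiable_def)
  then have "linear d" by (simp add: has_derivative_linear)
  then have "d = (\<lambda>k. k \<bullet> adjoint d 1)"
    using adjoint_works[of d _ 1] by (simp add: fun_eq_iff)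
  with d have D: "GDERIV (\<lambda>u. real_of_ereal (h u)) x :> adjoint d 1"
    by (simp add: gderiv_def inner_commute)
  show ?thesis
    unfolding gradient_def
  proof (rule theI[where P = "\<lambda>D. GDERIV (\<lambda>u. real_of_ereal (h u)) x :> D", OF D])
    fix D' assume "GDERIV (\<lambda>u. real_of_ereal (h u)) x :> D'"
    with D have "(\<lambda>k. k \<bullet> D') = (\<lambda>k. k \<bullet> adjoint d 1)"
      unfolding gderiv_def by (rule has_derivative_unique[rotated])
    then show "D' = adjoint d 1"
      by (metis inner_commute vector_eq_rdot)
  qed
qed

text \<open>Near \<open>x\<close>, \<open>h\<close> differs from its linearization by at most half
  of the permitted error; the other half is left for the given minorant. The same split works in
  both directions, because a finite \<open>h z\<close> can be moved across the inequality.\<close>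

lemma frechet_subdiff_add_smooth:
  fixes f h :: "'a::real_inner \<Rightarrow> ereal"
  assumes fx: "f x = ereal r"
    and fin: "\<forall>\<^sub>F z in nhds x. \<bar>h z\<bar> \<noteq> \<infinity>"
    and D: "GDERIV (\<lambda>u. real_of_ereal (h u)) x :> D"
  shows "v \<in> frechet_subdiff (\<lambda>z. f z + h z) x \<longleftrightarrow> v - D \<in> frechet_subdiff f x"
proof -
  let ?k = "\<lambda>z. real_of_ereal (h z)"
  have "\<bar>h x\<bar> \<noteq> \<infinity>" using fin by (rule eventually_nhds_x_imp_x)
  then have sx: "f x + h x = ereal (r + ?k x)" by (cases "h x") (simp_all add: fx)
  have err: "\<forall>\<^sub>F z in nhds x. \<bar>?k z - ?k x - D \<bullet> (z - x)\<bar> \<le> \<epsilon> * norm (z - x)" if "\<epsilon> > 0" for \<epsilon>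
  proof -
    have "(?k has_derivative (\<lambda>y. y \<bullet> D)) (at x)" using D by (simp add: gderiv_def inner_commute)
    then have "\<exists>d>0. \<forall>y. norm (y - x) < d \<longrightarrow>
        norm (?k y - ?k x - (y - x) \<bullet> D) \<le> \<epsilon> * norm (y - x)"
      using that by (simp only: has_derivative_at_alt)
    then show ?thesis
      unfolding eventually_nhds_metric dist_norm real_norm_def inner_commute[of D] by blast
  qed
  show ?thesis
    unfolding frechet_subdiff_iff[of "\<lambda>z. f z + h z", OF sx] frechet_subdiff_iff[of f, OF fx]
  proof (intro iffI allI impI)
    fix \<epsilon> :: real assume "\<epsilon> > 0"
      and *: "\<forall>\<epsilon>>0. \<forall>\<^sub>F z in nhds x.
        ereal (r + ?k x + v \<bullet> (z - x) - \<epsilon> * norm (z - x)) \<le> f z + h z"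
    then have "\<epsilon> / 2 > 0" by simp
    from fin err[OF this] *[rule_format, OF this]
    show "\<forall>\<^sub>F z in nhds x. ereal (r + (v - D) \<bullet> (z - x) - \<epsilon> * norm (z - x)) \<le> f z"
    proof eventually_elim
      case (elim z)
      then obtain k where k: "h z = ereal k" by (cases "h z") auto
      have err_z: "\<bar>k - ?k x - D \<bullet> (z - x)\<bar> \<le> \<epsilon> * norm (z - x) / 2"
        using elim(2) k by simp
      show ?case
      proof (cases "f z")
        case (real s)
        then have "r + ?k x + v \<bullet> (z - x) - \<epsilon> * norm (z - x) / 2 \<le> s + k"
          using elim(3) k by simp
        with err_z have "r + (v - D) \<bullet> (z - x) - \<epsilon> * norm (z - x) \<le> s"
          unfolding inner_diff_left abs_le_iff by linarith
        with real show ?thesis by simp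
      qed (use elim(3) k in simp_all)
    qed
  next
    fix \<epsilon> :: real assume "\<epsilon> > 0"
      and *: "\<forall>\<epsilon>>0. \<forall>\<^sub>F z in nhds x. ereal (r + (v - D) \<bullet> (z - x) - \<epsilon> * norm (z - x)) \<le> f z"
    then have "\<epsilon> / 2 > 0" by simp
    from fin err[OF this] *[rule_format, OF this]
    show "\<forall>\<^sub>F z in nhds x. ereal (r + ?k x + v \<bullet> (z - x) - \<epsilon> * norm (z - x)) \<le> f z + h z"
    proof eventually_elim
      case (elim z)
      then obtain k where k: "h z = ereal k" by (cases "h z") auto
      have err_z: "\<bar>k - ?k x - D \<bullet> (z - x)\<bar> \<le> \<epsilon> * norm (z - x) / 2"
        using elim(2) k by simp
      show ?case
      proof (cases "f z")
        case (real s)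
        then have "r + (v - D) \<bullet> (z - x) - \<epsilon> * norm (z - x) / 2 \<le> s"
          using elim(3) by simp
        with err_z have "r + ?k x + v \<bullet> (z - x) - \<epsilon> * norm (z - x) \<le> s + k"
          unfolding inner_diff_left abs_le_iff by linarith
        with real k show ?thesis by simp
      qed (use elim(3) k in simp_all)
    qed
  qed
qed

section \<open>Convex subgradients and the conjugate\<close>

text \<open>A hyperplane separates \<open>(x, g x)\<close> from the strict epigraph. It is not
  vertical because \<open>g\<close> is finite everywhere, so its normal can be scaled to give a
  subgradient.\<close>

lemma convex_subdiff_nonempty:
  fixes g :: "'a::euclidean_space \<Rightarrow> real"
  assumes "convex_on UNIV g"
  shows "convex_subdiff g x \<noteq> {}"
proof -
  let ?E = "{(z, t). g z < t}"
  have "convex ?E"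
    unfolding convex_def
  proof (clarsimp)
    fix z t z' t' and u v :: real
    assume *: "g z < t" "g z' < t'" "0 \<le> u" "0 \<le> v" "u + v = 1"
    have "g (u *\<^sub>R z + v *\<^sub>R z') \<le> u * g z + v * g z'"
      using assms * by (simp add: convex_on_def)
    also have "\<dots> < u * t + v * t'"
    proof (cases "u = 0")
      case True then show ?thesis using * by simp
    next
      case False
      then have "u * g z < u * t" using * by simp
      moreover have "v * g z' \<le> v * t'" using * by (simp add: mult_left_mono)
      ultimately show ?thesis by linarith
    qed
    finally show "g (u *\<^sub>R z + v *\<^sub>R z') < u * t + v * t'" .
  qed
  moreover have "(x, g x + 1) \<in> ?E" by simp
  then have "?E \<noteq> {}" by blast
  moreover have "{(x, g x)} \<inter> ?E = {}" by simp
  ultimately obtain w b where wb: "w \<noteq> 0" "w \<bullet> (x, g x) \<le> b" "\<And>p. p \<in> ?E \<Longrightarrow> b \<le> w \<bullet> p"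
    using separating_hyperplane_sets[of "{(x, g x)}" ?E, OF convex_singleton]
    by (metis insert_not_empty insertI1)
  obtain c \<beta> where w: "w = (c, \<beta>)" by (cases w)
  have sep: "c \<bullet> x + \<beta> * g x \<le> c \<bullet> z + \<beta> * t" if "g z < t" for z t
    using wb(2) wb(3)[of "(z, t)"] that by (simp add: w)
  have "0 \<le> \<beta>" using sep[of x "g x + 1"] by (simp add: algebra_simps)
  \<comment> \<open>A vertical hyperplane would constrain all \<open>z\<close>; testing it at
    \<open>x - c\<close> forces \<open>c = 0\<close>.\<close>
  moreover have "\<beta> \<noteq> 0"
  proof
    assume "\<beta> = 0"
    then have "c \<bullet> x \<le> c \<bullet> (x - c)" using sep[of "x - c" "g (x - c) + 1"] by simp
    then have "c \<bullet> c \<le> 0" by (simp add: inner_diff_right)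
    then have "c = 0" by (metis inner_eq_zero_iff inner_ge_zero order_antisym)
    with \<open>\<beta> = 0\<close> w wb(1) show False by (simp add: zero_prod_def)
  qed
  ultimately have "\<beta> > 0" by simp
  have "g x + (- c /\<^sub>R \<beta>) \<bullet> (z - x) \<le> g z" for z
  \<comment> \<open>Separation speaks only of heights strictly above \<open>g z\<close>; letting
    them decrease gives \<open>g z\<close> itself.\<close>
  proof (rule dense_ge)
    fix t assume "g z < t"
    have "(- c /\<^sub>R \<beta>) \<bullet> (z - x) = (c \<bullet> x - c \<bullet> z) / \<beta>"
      by (simp add: inner_diff_right divide_inverse algebra_simps)
    also have "\<dots> \<le> t - g x"
      unfolding pos_divide_le_eq[OF \<open>\<beta> > 0\<close>]
      using sep[OF \<open>g z < t\<close>] by (simp add: algebra_simps)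
    finally show "g x + (- c /\<^sub>R \<beta>) \<bullet> (z - x) \<le> t" by simp
  qed
  then show ?thesis unfolding convex_subdiff_def by blast
qed

lemma conjugate_le_iff: "conjugate g y \<le> ereal p \<longleftrightarrow> (\<forall>x. x \<bullet> y - g x \<le> p)"
  unfolding conjugate_def by (simp add: SUP_le_iff)

lemma conjugate_not_MInfty: "conjugate g y \<noteq> -\<infinity>"
proof -
  have "ereal (0 \<bullet> y - g 0) \<le> conjugate g y"
    unfolding conjugate_def by (rule SUP_upper) simp
  then show ?thesis by auto
qed

text \<open>For each fixed \<open>x\<close> the expression under the supremum is affine in
  \<open>y\<close>, so upper bounds at two points average.\<close>

lemma conjugate_convex_combination:
  assumes "conjugate g y \<le> ereal p" "conjugate g y' \<le> ereal p'" "0 \<le> t" "t \<le> 1"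
  shows "conjugate g (y + t *\<^sub>R (y' - y)) \<le> ereal ((1 - t) * p + t * p')"
  unfolding conjugate_le_iff
proof
  fix x
  have "x \<bullet> y - g x \<le> p" "x \<bullet> y' - g x \<le> p'"
    using assms(1,2) by (simp_all add: conjugate_le_iff)
  then have "(1 - t) * (x \<bullet> y - g x) + t * (x \<bullet> y' - g x) \<le> (1 - t) * p + t * p'"
    using assms(3,4) by (intro add_mono mult_left_mono) auto
  then show "x \<bullet> (y + t *\<^sub>R (y' - y)) - g x \<le> (1 - t) * p + t * p'"
    by (simp add: algebra_simps)
qed

text \<open>This is the equality case of the Fenchel-Young inequality, whose other half always
  holds.\<close>

lemma convex_subdiff_iff_conjugate_le:
  "y \<in> convex_subdiff g x \<longleftrightarrow> conjugate g y \<le> ereal (x \<bullet> y - g x)"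
  unfolding conjugate_le_iff convex_subdiff_def
  by (auto simp: inner_diff_right inner_commute algebra_simps)

section \<open>Stationarity of the quotient\<close>

text \<open>Where \<open>Q_fun\<close> is infinite by definition the right side is vacuous;
  elsewhere the positive denominator is multiplied out.\<close>

lemma le_Q_fun_iff:
  "ereal c \<le> Q_fun f g h (x, y) \<longleftrightarrow>
    (\<forall>p. x \<in> edom f \<longrightarrow> conjugate g y = ereal p \<longrightarrow> p < x \<bullet> y \<longrightarrow>
      ereal (c * (x \<bullet> y - p)) \<le> zeta f h x)"
proof (cases "conjugate g y")
  case (real p)
  show ?thesis
  proof (cases "x \<in> edom f \<and> p < x \<bullet> y")
    case True
    then have "0 < x \<bullet> y - p" by simp
    then show ?thesis using True real
      by (cases "zeta f h x") (auto simp: Q_fun_def eta_def edom_def pos_le_divide_eq)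
  qed (use real in \<open>auto simp: Q_fun_def eta_def\<close>)
qed (auto simp: Q_fun_def edom_def conjugate_not_MInfty)

text \<open>Only \<open>zeta\<close> appears here; its splitting into \<open>f\<close> and the
  gradient of \<open>h\<close> is left to the sum rule.\<close>

proposition zero_in_frechet_subdiff_Q_iff:
  fixes f h :: "'a::euclidean_space \<Rightarrow> ereal"
  assumes g: "convex_on UNIV g"
    and zeta_nonneg: "\<And>x. 0 \<le> zeta f h x"
    and zeta_infty: "\<And>x. x \<notin> edom f \<Longrightarrow> zeta f h x = \<infinity>"
    and x: "xs \<in> edom f" "zeta f h xs = ereal a"
    and y: "conjugate g ys = ereal p" "p < xs \<bullet> ys"
  shows "0 \<in> frechet_subdiff (Q_fun f g h) (xs, ys) \<longleftrightarrow>
    a = 0 \<or> ys \<in> convex_subdiff g xs \<and> (a / g xs) *\<^sub>R ys \<in> frechet_subdiff (zeta f h) xs"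
proof -
  define e where "e = xs \<bullet> ys - p"
  define G where "G = g xs"
  have "e > 0" using y(2) by (simp add: e_def)
  \<comment> \<open>Fenchel-Young; equality will mean that \<open>ys\<close> is a
    subgradient.\<close>
  have "e \<le> G"
    using conjugate_le_iff[of g ys p] y(1) by (simp add: e_def G_def algebra_simps)
  then have "G > 0" using \<open>e > 0\<close> by simp
  have "a \<ge> 0" using zeta_nonneg[of xs] x(2) by simp
  have Qs: "Q_fun f g h (xs, ys) = ereal (a / e)"
    using x y by (simp add: Q_fun_def eta_def edom_def e_def)
  have sub: "ys \<in> convex_subdiff g xs \<longleftrightarrow> e = G"
    using \<open>e \<le> G\<close> by (auto simp: convex_subdiff_iff_conjugate_le y(1) e_def G_def)
  have stat: "0 \<in> frechet_subdiff (Q_fun f g h) (xs, ys) \<longleftrightarrow>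
    (\<forall>\<epsilon>>0. \<forall>\<^sub>F w in nhds (xs, ys).
      ereal (a / e - \<epsilon> * norm (w - (xs, ys))) \<le> Q_fun f g h w)"
    unfolding frechet_subdiff_iff[of "Q_fun f g h", OF Qs] by simp
  note subdiff_zeta = frechet_subdiff_iff[of "zeta f h", OF x(2)]
  show ?thesis
  proof (cases "a = 0")
    case True
    have "0 \<in> frechet_subdiff (Q_fun f g h) (xs, ys)"
    proof (rule zero_in_frechet_subdiff_if_minimum)
      show "Q_fun f g h (xs, ys) = ereal 0" using Qs True by simp
      show "ereal 0 \<le> Q_fun f g h w" for w
        using zeta_nonneg by (cases w, simp only: le_Q_fun_iff) (simp flip: zero_ereal_def)
    qed
    with True show ?thesis by simp
  next
    case False
    with \<open>a \<ge> 0\<close> have "a > 0" by simp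
    have "e = G \<and> (a / G) *\<^sub>R ys \<in> frechet_subdiff (zeta f h) xs"
      if "0 \<in> frechet_subdiff (Q_fun f g h) (xs, ys)"
    proof -
      note Q_ge = that[unfolded stat, rule_format]
      have "e = G"
      proof (rule ccontr)
        assume "e \<noteq> G"
        with \<open>e \<le> G\<close> have "e < G" by simp
        define \<delta> where "\<delta> = G - e"
        \<comment> \<open>The denominator at \<open>xs\<close> reaches \<open>G\<close> at
          \<open>q\<close>, so moving a fraction \<open>t\<close> of the way from \<open>ys\<close>
          to \<open>q\<close> raises it by at least \<open>t * \<delta>\<close>.\<close>
        obtain q where "q \<in> convex_subdiff g xs" using convex_subdiff_nonempty[OF g] by blast
        then have q: "conjugate g q \<le> ereal (xs \<bullet> q - G)"
          by (simp add: convex_subdiff_iff_conjugate_le G_def)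
        define N where "N = norm (q - ys)"
        have "q \<noteq> ys" using q y(1) \<open>e < G\<close> by (auto simp: e_def)
        then have "N > 0" by (simp add: N_def)
        have "\<delta> > 0" using \<open>e < G\<close> by (simp add: \<delta>_def)
        \<comment> \<open>Over a displacement \<open>t * N\<close> this permits the quotient to drop
          only by the fraction \<open>t * \<delta> / (2 * G)\<close> of \<open>a / e\<close>, less
          than the growing denominator causes.\<close>
        define \<epsilon> where "\<epsilon> = a * \<delta> / (2 * e * G * N)"
        have "\<epsilon> > 0" using \<open>a > 0\<close> \<open>\<delta> > 0\<close> \<open>e > 0\<close> \<open>G > 0\<close> \<open>N > 0\<close> by (simp add: \<epsilon>_def)
        from Q_ge[OF this] obtain d where "d > 0" and
          d: "\<And>w. dist w (xs, ys) < d \<Longrightarrow>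
            ereal (a / e - \<epsilon> * norm (w - (xs, ys))) \<le> Q_fun f g h w"
          unfolding eventually_nhds_metric by auto
        define t where "t = min 1 (d / (2 * N))"
        have t: "0 < t" "t \<le> 1" "t * N < d"
        proof -
          show "0 < t" "t \<le> 1" using \<open>d > 0\<close> \<open>N > 0\<close> by (simp_all add: t_def)
          have "t * N \<le> d / (2 * N) * N" using \<open>N > 0\<close> by (intro mult_right_mono) (auto simp: t_def)
          also have "\<dots> < d" using \<open>N > 0\<close> \<open>d > 0\<close> by simp
          finally show "t * N < d" .
        qed
        let ?y = "ys + t *\<^sub>R (q - ys)"
        have conj_le: "conjugate g ?y \<le> ereal ((1 - t) * p + t * (xs \<bullet> q - G))"
          using conjugate_convex_combination[of g ys p q, OF _ q] y(1) t by simp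
        then obtain p' where p': "conjugate g ?y = ereal p'"
          using conjugate_not_MInfty[of g ?y] by (cases "conjugate g ?y") auto
        define e' where "e' = xs \<bullet> ?y - p'"
        have "e + t * \<delta> \<le> e'"
          using conj_le p' by (simp add: e'_def e_def \<delta>_def algebra_simps)
        have "e' > 0"
        proof -
          have "0 < t * \<delta>" using t \<open>\<delta> > 0\<close> by simp
          then show ?thesis using \<open>e + t * \<delta> \<le> e'\<close> \<open>e > 0\<close> by linarith
        qed
        have nw: "norm ((xs, ?y) - (xs, ys)) = t * N"
          using t by (simp add: norm_Pair N_def)
        have "ereal (a / e - \<epsilon> * (t * N)) \<le> Q_fun f g h (xs, ?y)"
          using d[of "(xs, ?y)"] t(3) nw by (simp only: dist_norm)
        then have "(a / e - \<epsilon> * (t * N)) * e' \<le> a"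
          using x p' \<open>e' > 0\<close> unfolding le_Q_fun_iff by (simp add: e'_def)
        moreover have "a / e - \<epsilon> * (t * N) = a / e * (1 - t * \<delta> / (2 * G))"
          using \<open>N > 0\<close> \<open>e > 0\<close> \<open>G > 0\<close> by (simp add: \<epsilon>_def field_simps)
        moreover have "t * \<delta> \<le> \<delta>" using t \<open>\<delta> > 0\<close> by simp
        then have "t * \<delta> \<le> G" "e + t * \<delta> \<le> G" using \<open>e > 0\<close> by (simp_all add: \<delta>_def)
        \<comment> \<open>This sign allows \<open>e'\<close> to be replaced by its lower
          bound.\<close>
        then have "0 \<le> a / e * (1 - t * \<delta> / (2 * G))"
          using \<open>a > 0\<close> \<open>e > 0\<close> \<open>G > 0\<close> by (intro mult_nonneg_nonneg) (auto simp: field_simps)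
        then have "a / e * (1 - t * \<delta> / (2 * G)) * (e + t * \<delta>) \<le> a / e * (1 - t * \<delta> / (2 * G)) * e'"
          using \<open>e + t * \<delta> \<le> e'\<close> by (rule mult_left_mono[rotated])
        ultimately have "a / e * ((1 - t * \<delta> / (2 * G)) * (e + t * \<delta>)) \<le> a / e * e"
          using \<open>e > 0\<close> by simp
        then have "(1 - t * \<delta> / (2 * G)) * (e + t * \<delta>) \<le> e"
          using \<open>a > 0\<close> \<open>e > 0\<close> by (simp only: mult_le_cancel_left_pos divide_pos_pos)
        \<comment> \<open>Expanding the product and cancelling \<open>e\<close> and then
          \<open>t * \<delta>\<close> leaves a bound that contradicts
          \<open>e + t * \<delta> \<le> G\<close>.\<close>
        then have "t * \<delta> * 1 \<le> t * \<delta> * ((e + t * \<delta>) / (2 * G))"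
          by (simp add: algebra_simps)
        then have "1 \<le> (e + t * \<delta>) / (2 * G)"
          using t(1) \<open>\<delta> > 0\<close> by (simp only: mult_le_cancel_left_pos mult_pos_pos)
        then show False using \<open>e + t * \<delta> \<le> G\<close> \<open>G > 0\<close> by (simp add: field_simps)
      qed
      moreover have "(a / G) *\<^sub>R ys \<in> frechet_subdiff (zeta f h) xs"
        unfolding subdiff_zeta
      proof (intro allI impI)
        fix \<epsilon> :: real assume "\<epsilon> > 0"
        \<comment> \<open>The denominator stays below \<open>2 * G\<close> near \<open>xs\<close>,
          so multiplying by it restores an error of at most
          \<open>\<epsilon> * norm (u - xs)\<close>.\<close>
        then have "\<epsilon> / (2 * G) > 0" using \<open>G > 0\<close> by simp
        note ev = Q_ge[OF this]
        \<comment> \<open>The estimate is restricted to the slice with second component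
          \<open>ys\<close>.\<close>
        have "((\<lambda>u. (u, ys)) \<longlongrightarrow> (xs, ys)) (nhds xs)"
          by (intro tendsto_Pair tendsto_const filterlim_ident)
        from eventually_compose_filterlim[OF ev this]
        have ev1: "\<forall>\<^sub>F u in nhds xs. ereal (a / G - \<epsilon> / (2 * G) * norm (u - xs)) \<le> Q_fun f g h (u, ys)"
          by (simp add: \<open>e = G\<close> norm_Pair)
        have "((\<lambda>u. u \<bullet> ys - p) \<longlongrightarrow> G) (nhds xs)"
          unfolding \<open>e = G\<close>[symmetric] e_def by (intro tendsto_intros filterlim_ident)
        then have "\<forall>\<^sub>F u in nhds xs. 0 < u \<bullet> ys - p" "\<forall>\<^sub>F u in nhds xs. u \<bullet> ys - p < 2 * G"
          by (rule order_tendstoD; use \<open>G > 0\<close> in simp)+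
        with ev1 show "\<forall>\<^sub>F u in nhds xs.
          ereal (a + (a / G) *\<^sub>R ys \<bullet> (u - xs) - \<epsilon> * norm (u - xs)) \<le> zeta f h u"
        proof eventually_elim
          case (elim u)
          show ?case
          proof (cases "u \<in> edom f")
            case True
            let ?n = "u \<bullet> ys - p"
            have "ereal ((a / G - \<epsilon> / (2 * G) * norm (u - xs)) * ?n) \<le> zeta f h u"
              using elim(1,2) True y(1) unfolding le_Q_fun_iff by simp
            moreover have "a + (a / G) *\<^sub>R ys \<bullet> (u - xs) - \<epsilon> * norm (u - xs)
              \<le> (a / G - \<epsilon> / (2 * G) * norm (u - xs)) * ?n"
            proof -
              \<comment> \<open>The denominator is exactly affine in \<open>u\<close>, so
                \<open>a / G\<close> times it is the required linear model without
                remainder.\<close>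
              have "?n = G + ys \<bullet> (u - xs)"
                using \<open>e = G\<close> by (simp add: e_def inner_diff_right inner_commute)
              then have "a / G * ?n = a + (a / G) *\<^sub>R ys \<bullet> (u - xs)"
                using \<open>G > 0\<close> by (simp add: distrib_left)
              moreover have "\<epsilon> / (2 * G) * norm (u - xs) * ?n \<le> \<epsilon> / (2 * G) * norm (u - xs) * (2 * G)"
                using elim(3) \<open>\<epsilon> > 0\<close> \<open>G > 0\<close> by (intro mult_left_mono) auto
              moreover have "\<epsilon> / (2 * G) * norm (u - xs) * (2 * G) = \<epsilon> * norm (u - xs)"
                using \<open>G > 0\<close> by simp
              ultimately show ?thesis by (simp only: left_diff_distrib)
            qed
            ultimately show ?thesis by (meson ereal_less_eq(3) order_trans)
          qed (simp add: zeta_infty)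
        qed
      qed
      ultimately show ?thesis by blast
    qed
    moreover have "0 \<in> frechet_subdiff (Q_fun f g h) (xs, ys)"
      if "e = G" and sz: "(a / G) *\<^sub>R ys \<in> frechet_subdiff (zeta f h) xs"
      unfolding stat
    proof (intro allI impI)
      fix \<epsilon> :: real assume "\<epsilon> > 0"
      \<comment> \<open>Two errors of size \<open>\<epsilon>' * n\<close> must fit into
        \<open>\<epsilon> * n * k\<close> when \<open>k > G / 2\<close>.\<close>
      define \<epsilon>' where "\<epsilon>' = \<epsilon> * G / 4"
      have "\<epsilon>' > 0" using \<open>\<epsilon> > 0\<close> \<open>G > 0\<close> by (simp add: \<epsilon>'_def)
      let ?m = "\<lambda>u. a + (a / G) *\<^sub>R ys \<bullet> (u - xs) - \<epsilon>' * norm (u - xs)"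
      have "(?m \<longlongrightarrow> a + (a / G) *\<^sub>R ys \<bullet> (xs - xs) - \<epsilon>' * norm (xs - xs)) (nhds xs)"
        by (intro tendsto_intros filterlim_ident)
      then have "(?m \<longlongrightarrow> a) (nhds xs)" by simp
      then have "\<forall>\<^sub>F u in nhds xs. a / 2 < ?m u"
        by (rule order_tendstoD) (use \<open>a > 0\<close> in simp)
      moreover have "\<forall>\<^sub>F u in nhds xs. ereal (?m u) \<le> zeta f h u"
        using sz \<open>\<epsilon>' > 0\<close> unfolding subdiff_zeta by blast
      ultimately have ev1: "\<forall>\<^sub>F u in nhds xs. a / 2 < ?m u \<and> ereal (?m u) \<le> zeta f h u"
        by eventually_elim blast
      \<comment> \<open>With this radius for \<open>v\<close>, the cross term
        \<open>(v - ys) \<bullet> (u - xs)\<close>, multiplied by \<open>a / G\<close>, is at most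
        \<open>\<epsilon>' * n\<close>.\<close>
      have "\<epsilon>' * G / a > 0" using \<open>\<epsilon>' > 0\<close> \<open>G > 0\<close> \<open>a > 0\<close> by simp
      then have ev2: "\<forall>\<^sub>F v in nhds ys. norm (v - ys) < \<epsilon>' * G / a"
        unfolding eventually_nhds_metric dist_norm by blast
      from ev1 ev2
      have "\<forall>\<^sub>F w in nhds (xs, ys). (a / 2 < ?m (fst w) \<and> ereal (?m (fst w)) \<le> zeta f h (fst w)) \<and>
          norm (snd w - ys) < \<epsilon>' * G / a"
        unfolding nhds_prod by (intro iffD2[OF eventually_prod_filter] exI conjI) auto
      then show "\<forall>\<^sub>F w in nhds (xs, ys).
          ereal (a / e - \<epsilon> * norm (w - (xs, ys))) \<le> Q_fun f g h w"
      proof eventually_elim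
        case (elim w)
        obtain u v where w: "w = (u, v)" by (cases w)
        define n where "n = norm (w - (xs, ys))"
        have "norm (u - xs) \<le> n"
          using norm_fst_le[of "u - xs" "v - ys"] by (simp add: n_def w)
        then have "n \<ge> 0" using norm_ge_zero order_trans by blast
        have m: "a / 2 < ?m u" "ereal (?m u) \<le> zeta f h u" and v: "norm (v - ys) < \<epsilon>' * G / a"
          using elim by (auto simp: w)
        show ?case
          unfolding w[symmetric] n_def[symmetric] unfolding w le_Q_fun_iff
        proof (intro allI impI)
          fix p' assume p': "conjugate g v = ereal p'" "p' < u \<bullet> v"
          define k where "k = u \<bullet> v - p'"
          have "k > 0" using p' by (simp add: k_def)
          have "(a / e - \<epsilon> * n) * k \<le> ?m u"
          proof (cases "k \<le> G / 2")
            \<comment> \<open>A small denominator gives at most \<open>a / 2\<close> on the left,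
              which lies below \<open>?m u\<close>.\<close>
            case True
            have "(a / e - \<epsilon> * n) * k \<le> a / G * k"
              using \<open>k > 0\<close> \<open>\<epsilon> > 0\<close> \<open>n \<ge> 0\<close> by (intro mult_right_mono) (auto simp: \<open>e = G\<close>)
            also have "\<dots> \<le> a / G * (G / 2)"
              using True \<open>a > 0\<close> \<open>G > 0\<close> by (intro mult_left_mono) auto
            also have "\<dots> < ?m u" using m(1) \<open>G > 0\<close> by simp
            finally show ?thesis by simp
          next
            case False
            \<comment> \<open>Fenchel-Young at \<open>xs\<close> bounds \<open>k\<close> by its
              linear model at \<open>ys\<close> plus the cross term.\<close>
            have "xs \<bullet> v - p' \<le> G"
              using conjugate_le_iff[of g v p'] p'(1) by (simp add: G_def algebra_simps)
            then have "k \<le> G + ys \<bullet> (u - xs) + (v - ys) \<bullet> (u - xs)"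
              by (simp add: k_def algebra_simps inner_commute)
            also have "(v - ys) \<bullet> (u - xs) \<le> norm (v - ys) * norm (u - xs)"
              by (rule norm_cauchy_schwarz)
            also have "\<dots> \<le> \<epsilon>' * G / a * n"
              using v \<open>norm (u - xs) \<le> n\<close> \<open>\<epsilon>' * G / a > 0\<close> by (intro mult_mono) auto
            finally have "k \<le> G + ys \<bullet> (u - xs) + \<epsilon>' * G / a * n" by simp
            then have "a / G * k \<le> a / G * (G + ys \<bullet> (u - xs) + \<epsilon>' * G / a * n)"
              using \<open>a > 0\<close> \<open>G > 0\<close> by (intro mult_left_mono) auto
            also have "\<dots> = a + (a / G) *\<^sub>R ys \<bullet> (u - xs) + \<epsilon>' * n"
              using \<open>a > 0\<close> \<open>G > 0\<close> by (simp add: distrib_left)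
            finally have 1: "a / G * k \<le> a + (a / G) *\<^sub>R ys \<bullet> (u - xs) + \<epsilon>' * n" .
            have 2: "\<epsilon>' * norm (u - xs) \<le> \<epsilon>' * n"
              using \<open>norm (u - xs) \<le> n\<close> \<open>\<epsilon>' > 0\<close> by simp
            have "\<epsilon> * n * (G / 2) \<le> \<epsilon> * n * k"
              using False \<open>\<epsilon> > 0\<close> \<open>n \<ge> 0\<close> by (intro mult_left_mono) auto
            then have 3: "2 * (\<epsilon>' * n) \<le> \<epsilon> * n * k" by (simp add: \<epsilon>'_def algebra_simps)
            show ?thesis
              unfolding \<open>e = G\<close> left_diff_distrib using 1 2 3 by linarith
          qed
          with m(2) show "ereal ((a / e - \<epsilon> * n) * (u \<bullet> v - p')) \<le> zeta f h u"
            unfolding k_def by (meson ereal_less_eq(3) order_trans)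
        qed
      qed
    qed
    ultimately show ?thesis
      using False sub unfolding G_def by blast
  qed
qed

section \<open>Critical points of \<open>F_fun\<close> and stationary points of
  \<open>Q_fun\<close>\<close>

theorem proposition3p2:
  fixes f h :: "real ^ 'n \<Rightarrow> ereal" and g :: "real ^ 'n \<Rightarrow> real"
    and P :: "'n set set" and fb :: "'n set \<Rightarrow> real ^ 'n \<Rightarrow> ereal"
    and xs ys :: "real ^ 'n"
  assumes f: "proper f" "lsc f"
    and g: "lsc (\<lambda>x. ereal (g x))"
    and h: "proper h" "lsc h"
    and Omega_nonempty: "Omega g \<noteq> {}"
    and partition: "partition_on UNIV P"
    and f_separable: "\<And>x. f x = (\<Sum>B\<in>P. fb B (block B x))"
    and fb_proper: "\<And>B. B \<in> P \<Longrightarrow> proper (\<lambda>x. fb B (block B x))"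
    and fb_lsc: "\<And>B. B \<in> P \<Longrightarrow> lsc (\<lambda>x. fb B (block B x))"
    and f_continuous: "continuous_on (edom f) f"
    and fb_bounded: "\<And>B. B \<in> P \<Longrightarrow> bounded_from_below (\<lambda>x. fb B (block B x))"
    and h_smooth: "locally_lipschitz_differentiable_on h (Omega g)"
    and g_convex: "convex_on UNIV g"
    and g_nonneg: "\<And>x. 0 \<le> g x"
    and zeta_nonneg: "\<And>x. x \<in> edom f \<Longrightarrow> 0 \<le> f x + h x"
    and dom_Q: "(xs, ys) \<in> edom (Q_fun f g h)"
    and conj_continuous: "continuous_on (edom (conjugate g)) (conjugate g)"
  shows "(critical_point f g h xs \<and>
          real_of_ereal (F_fun f g h xs) *\<^sub>R ys
            \<in> scaled_set (real_of_ereal (F_fun f g h xs)) (convex_subdiff g xs)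
              \<inter> (gradient h xs +o frechet_subdiff f xs))
         \<longleftrightarrow> 0 \<in> frechet_subdiff (Q_fun f g h) (xs, ys)"
proof -
  have xs: "xs \<in> edom f" and "conjugate g ys < \<infinity>" and eta_pos: "eta g xs ys > 0"
    using dom_Q by (auto simp: edom_def Q_fun_def split: if_splits)
  then obtain p where p: "conjugate g ys = ereal p"
    using conjugate_not_MInfty[of g ys] by (cases "conjugate g ys") auto
  have "p < xs \<bullet> ys" using eta_pos p by (simp add: eta_def)
  \<comment> \<open>\<open>g xs\<close> dominates the positive denominator, which places
    \<open>xs\<close> in \<open>Omega g\<close>.\<close>
  moreover have "xs \<bullet> ys - g xs \<le> p" using conjugate_le_iff[of g ys p] p by simp
  ultimately have "g xs > 0" by simp
  then have Om: "xs \<in> Omega g" by (simp add: Omega_def)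
  \<comment> \<open>Openness turns finiteness of \<open>h\<close> on \<open>Omega g\<close> into
    finiteness near \<open>xs\<close>, as the sum rule requires.\<close>
  have "open (Omega g)"
  proof -
    have "continuous_on UNIV g" using g_convex by (intro convex_on_continuous) auto
    then show ?thesis unfolding Omega_def by (simp add: open_Collect_neq)
  qed
  have h_fin: "\<bar>h z\<bar> \<noteq> \<infinity>" if "z \<in> Omega g" for z
    using h_smooth that by (simp add: locally_lipschitz_differentiable_on_def)
  have h_fin': "\<forall>\<^sub>F z in nhds xs. \<bar>h z\<bar> \<noteq> \<infinity>"
    using eventually_nhds_in_open[OF \<open>open (Omega g)\<close> Om] by eventually_elim (rule h_fin)
  define D where "D = gradient h xs"
  have D: "GDERIV (\<lambda>u. real_of_ereal (h u)) xs :> D"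
    unfolding D_def using h_smooth Om
    by (intro GDERIV_gradient) (auto simp: locally_lipschitz_differentiable_on_def)
  obtain fr where fr: "f xs = ereal fr"
    using xs f(1) by (cases "f xs") (auto simp: edom_def proper_def)
  obtain hr where hr: "h xs = ereal hr"
    using h_fin[OF Om] by (cases "h xs") auto
  define a where "a = fr + hr"
  have zxs: "zeta f h xs = ereal a" by (simp add: zeta_def fr hr a_def)
  have z_infty: "zeta f h x = \<infinity>" if "x \<notin> edom f" for x
    using that h(1) by (simp add: edom_def zeta_def proper_def)
  have z_nonneg: "0 \<le> zeta f h x" for x
    using zeta_nonneg[of x] z_infty[of x] by (cases "x \<in> edom f") (auto simp: zeta_def)
  define c where "c = a / g xs"
  have F: "F_fun f g h xs = ereal c"
    using \<open>g xs > 0\<close> Om xs zxs by (simp add: F_fun_def c_def)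
  have sum_rule: "v \<in> frechet_subdiff (zeta f h) xs \<longleftrightarrow> v - D \<in> frechet_subdiff f xs" for v
    using frechet_subdiff_add_smooth[of f, OF fr h_fin' D] by (simp add: zeta_def[abs_def])
  have plus: "c *\<^sub>R ys \<in> D +o frechet_subdiff f xs \<longleftrightarrow> c *\<^sub>R ys \<in> frechet_subdiff (zeta f h) xs"
    unfolding sum_rule elt_set_plus_def by (auto intro: bexI[of _ "c *\<^sub>R ys - D"])
  \<comment> \<open>For \<open>a = 0\<close> the scaled set is exactly the zero vector, the
    subdifferential being nonempty, and nothing is said about \<open>ys\<close>.\<close>
  have scaled: "c *\<^sub>R ys \<in> scaled_set c (convex_subdiff g xs) \<longleftrightarrow> a = 0 \<or> ys \<in> convex_subdiff g xs"
    using convex_subdiff_nonempty[OF g_convex, of xs] \<open>g xs > 0\<close>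
    by (auto simp: scaled_set_def c_def)
  have crit: "critical_point f g h xs"
    if "c *\<^sub>R ys \<in> scaled_set c (convex_subdiff g xs)"
      and "c *\<^sub>R ys \<in> frechet_subdiff (zeta f h) xs"
  proof -
    \<comment> \<open>The witnesses for criticality are \<open>u = c *\<^sub>R ys - D\<close> and
      \<open>w = c *\<^sub>R ys\<close>.\<close>
    have "0 = (c *\<^sub>R ys - D) + D - c *\<^sub>R ys" by simp
    then show ?thesis
      using that unfolding sum_rule critical_point_def F D_def[symmetric] real_of_ereal.simps
      by (intro conjI CollectI exI) (auto simp: edom_def F)
  qed
  have zero: "c *\<^sub>R ys \<in> frechet_subdiff (zeta f h) xs" if "a = 0"
    using zero_in_frechet_subdiff_if_minimum[of "zeta f h" xs 0] that zxs z_nonneg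
    by (simp add: c_def flip: zero_ereal_def)
  have "0 \<in> frechet_subdiff (Q_fun f g h) (xs, ys) \<longleftrightarrow>
      a = 0 \<or> ys \<in> convex_subdiff g xs \<and> c *\<^sub>R ys \<in> frechet_subdiff (zeta f h) xs"
    unfolding c_def
    by (rule zero_in_frechet_subdiff_Q_iff[OF g_convex z_nonneg z_infty xs zxs p \<open>p < xs \<bullet> ys\<close>])
  \<comment> \<open>By \<open>crit\<close>, criticality follows from the two memberships of
    \<open>c *\<^sub>R ys\<close>, which \<open>scaled\<close> and \<open>plus\<close> translate;
    \<open>zero\<close> settles \<open>a = 0\<close>.\<close>
  then show ?thesis
    using crit scaled plus zero unfolding F D_def real_of_ereal.simps by blast
qed

end
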